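(* Let $A_0\in M_n^h(\mathbb{C})$, for $y\in\mathbb{R}^n$ let $A(y)=A_0+\mathrm{Diag}(y)$, and let $x\in\mathbb{R}^n$ be such that $\lambda_1(A(x))=-\lambda_n(A(x))$. Let $S_1$ and $S_n$ be the eigenspaces of $A(x)$ for $\lambda_1(A(x))$ and $\lambda_n(A(x))$, respectively. Then the following statements are equivalent: (1) $0\in\partial N(x)$, where $N:\mathbb{R}^n\to\mathbb{R}$, $N(y)=\|A(y)\|$. (2) $0\in\partial f(x)+\partial g(x)$, where $f,g:\mathbb{R}^n\to\mathbb{R}$ are the convex functions $f(y)=\lambda_1(A(y))$ and $g(y)=-\lambda_n(A(y))$. (3) $m_{S_1}\cap m_{S_n}\ne\emptyset$. (4) $W\left(\{P_{S_1}e_ie_i^*P_{S_1}\}_{i=1}^n\right)\cap W\left(\{P_{S_n}e_ie_i^*P_{S_n}\}_{i=1}^n\right)\ne\{0\}$. (5) $A(x)$ is minimal, that is, $\|A(x)\|\le\|A(y)\|$ for every $y\in\mathbb{R}^n$.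
   Context: $M_n^h(\mathbb{C})$ is the set of Hermitian $n\times n$ complex matrices, $\lambda_1(M)$ and $\lambda_n(M)$ are the maximum and minimum eigenvalues of $M\in M_n^h(\mathbb{C})$, $\|\cdot\|$ is the spectral norm, $\mathrm{Diag}(y)$ is the diagonal matrix with diagonal $y$, and $\{e_i\}_{i=1}^n$ is the canonical basis of $\mathbb{C}^n$. For a convex function $f:\mathbb{R}^n\to\mathbb{R}$, $\partial f(x)=\{v\in\mathbb{R}^n: f(y)-f(x)\ge\langle v,y-x\rangle\ \forall y\in\mathbb{R}^n\}$. For a subspace $S\subset\mathbb{C}^n$, $P_S$ is the orthogonal projection onto $S$ and the moment of $S$ is $m_S=\mathrm{co}\{|v|^2:v\in S,\|v\|=1\}$, where $\mathrm{co}$ is the convex hull and $|v|^2=(|v_1|^2,\dots,|v_n|^2)$. The joint numerical range of Hermitian matrices $A_1,\dots,A_n\in M_n^h(\mathbb{C})$ is $W(\{A_j\}_{j=1}^n)=\{(\mathrm{tr}(\rho A_1),\dots,\mathrm{tr}(\rho A_n)):\rho\in M_n^h(\mathbb{C}),\ \rho\ge0,\ \mathrm{tr}(\rho)=1\}$. *)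

theory Defs
  imports "HOL-Analysis.Analysis" "HOL-Library.Set_Algebras"
begin

definition hermitian :: "complex^'n^'n \<Rightarrow> bool" where
  "hermitian A \<longleftrightarrow> (\<forall>i j. A $ i $ j = cnj (A $ j $ i))"

text \<open>The inner product of \<^typ>\<open>complex^'n\<close> is the real part of the standard complex one. The
  quadratic form of a Hermitian matrix is real-valued, so no information is lost here.\<close>

definition psd :: "complex^'n^'n \<Rightarrow> bool" where
  "psd A \<longleftrightarrow> hermitian A \<and> (\<forall>v. 0 \<le> inner v (A *v v))"

definition diag_mat :: "real^'n \<Rightarrow> complex^'n^'n" where
  "diag_mat y = (\<chi> i j. if i = j then complex_of_real (y $ i) else 0)"

text \<open>The norm of \<^typ>\<open>complex^'n\<close> is the Euclidean one, so the operator norm is the spectral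
  norm; the library norm on the matrix type is the Frobenius norm.\<close>

definition spectral_norm :: "complex^'n^'n \<Rightarrow> real" where
  "spectral_norm A = onorm (\<lambda>v. A *v v)"

definition eigenspace :: "complex^'n^'n \<Rightarrow> complex \<Rightarrow> (complex^'n) set" where
  "eigenspace A l = {v. A *v v = l *s v}"

definition eigenvalues :: "complex^'n^'n \<Rightarrow> complex set" where
  "eigenvalues A = {l. \<exists>v. v \<noteq> 0 \<and> A *v v = l *s v}"

text \<open>Intended for Hermitian matrices, whose eigenvalues are all real.\<close>

definition lambda_max :: "complex^'n^'n \<Rightarrow> real" where
  "lambda_max A = Max {l. complex_of_real l \<in> eigenvalues A}"

definition lambda_min :: "complex^'n^'n \<Rightarrow> real" where
  "lambda_min A = Min {l. complex_of_real l \<in> eigenvalues A}"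

definition subdifferential :: "('a::real_inner \<Rightarrow> real) \<Rightarrow> 'a \<Rightarrow> 'a set" where
  "subdifferential f x = {v. \<forall>y. f y - f x \<ge> inner v (y - x)}"

definition abs_sq :: "complex^'n \<Rightarrow> real^'n" where
  "abs_sq v = (\<chi> i. (cmod (v $ i))\<^sup>2)"

definition moment :: "(complex^'n) set \<Rightarrow> (real^'n) set" where
  "moment S = convex hull {abs_sq v | v. v \<in> S \<and> norm v = 1}"

text \<open>The orthogonal projection onto a complex subspace, as the Hermitian idempotent matrix whose
  range is that subspace.\<close>

definition orth_proj :: "(complex^'n) set \<Rightarrow> complex^'n^'n" where
  "orth_proj S = (THE P. hermitian P \<and> P ** P = P \<and> range (\<lambda>v. P *v v) = S)"

text \<open>The matrix \<open>v v*\<close>.\<close>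

definition outer :: "complex^'n \<Rightarrow> complex^'n^'n" where
  "outer v = (\<chi> i j. v $ i * cnj (v $ j))"

text \<open>The traces are real for Hermitian \<open>A j\<close>; they are kept as complex numbers.\<close>

definition joint_numerical_range :: "('k \<Rightarrow> complex^'n^'n) \<Rightarrow> (complex^'k) set" where
  "joint_numerical_range A = {(\<chi> j. trace (\<rho> ** A j)) | \<rho>. psd \<rho> \<and> trace \<rho> = 1}"

definition compressed_basis :: "(complex^'n) set \<Rightarrow> 'n \<Rightarrow> complex^'n^'n" where
  "compressed_basis S i = orth_proj S ** outer (axis i 1) ** orth_proj S"

end

(* Near x, N is the maximum of the convex functions f and g, which agree at x. The unit vectors of the
   top eigenspace S1 yield subgradients |v|^2 of f, those of Sn yield subgradients -|v|^2 of g, so a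
   common point of the two moments makes 0 a subgradient of f + g and hence x a minimizer. If the
   moments are disjoint, a separating hyperplane gives a direction along which f and g both decrease.
   The joint numerical range of the compressed basis consists of the diagonals of P rho P; writing a
   positive semidefinite matrix with range in S as a sum of outer products v v* with v in S puts its
   diagonal in the cone over the moment of S. When A(x) is nonzero, both ranges contain 0, because both
   eigenspaces are proper, and the condition is about a nonzero common point of the cones; when
   A(x) = 0 the two eigenspaces coincide. *)

theory Submission
  imports Defs
begin

section \<open>Hermitian matrices\<close>

lemma of_real_vector_scalar_mult: "complex_of_real r *s v = r *\<^sub>R v"
  by (simp add: vec_eq_iff scaleR_conv_of_real[symmetric])

lemma subspace_imp_real_subspace:
  fixes S :: "(complex^'n) set"
  assumes "vec.subspace S"
  shows "subspace S"
proof (rule subspaceI)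
  show "c *\<^sub>R v \<in> S" if "v \<in> S" for c v
    using vec.subspace_scale[OF assms that, of "complex_of_real c"]
    by (simp add: of_real_vector_scalar_mult)
qed (use assms in \<open>auto simp: vec.subspace_0 vec.subspace_add\<close>)

lemma inner_complex_vec: "inner u v = (\<Sum>i\<in>UNIV. Re (cnj (u $ i) * v $ i))"
  for u v :: "complex^'n"
  by (simp add: inner_vec_def inner_complex_def)

lemma hermitian_self_adjoint:
  assumes "hermitian A"
  shows "inner u (A *v v) = inner (A *v u) v"
proof -
  have eq: "Re (cnj (u $ i) * (A $ i $ j * v $ j)) = Re (cnj (A $ j $ i * u $ i) * v $ j)" for i j
    using assms unfolding hermitian_def
    by (metis complex_cnj_mult mult.left_commute mult.assoc)
  have "inner u (A *v v) = (\<Sum>i\<in>UNIV. \<Sum>j\<in>UNIV. Re (cnj (u $ i) * (A $ i $ j * v $ j)))"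
    by (simp only: inner_complex_vec matrix_vector_mult_def vec_lambda_beta sum_distrib_left Re_sum)
  also have "\<dots> = (\<Sum>j\<in>UNIV. \<Sum>i\<in>UNIV. Re (cnj (A $ j $ i * u $ i) * v $ j))"
    by (subst sum.swap) (simp only: eq)
  also have "\<dots> = inner (A *v u) v"
    by (simp only: inner_complex_vec matrix_vector_mult_def vec_lambda_beta sum_distrib_right
        cnj_sum Re_sum)
  finally show ?thesis .
qed

lemma matrix_vector_mult_axis: "(A *v axis j c) $ i = A $ i $ j * c"
  for A :: "'a::semiring_1^'n^'m"
proof -
  have "(A *v axis j c) $ i = (\<Sum>k\<in>UNIV. if k = j then A $ i $ j * c else 0)"
    unfolding matrix_vector_mult_def axis_def vec_lambda_beta by (rule sum.cong) auto
  then show ?thesis by simp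
qed

lemma hermitian_iff_self_adjoint:
  "hermitian A \<longleftrightarrow> (\<forall>u v. inner u (A *v v) = inner (A *v u) v)"
proof
  assume *: "\<forall>u v. inner u (A *v v) = inner (A *v u) v"
  show "hermitian A"
    unfolding hermitian_def
  proof (intro allI complex_eqI)
    fix i j
    have "inner (axis i 1) (A *v axis j 1) = inner (A *v axis i 1) (axis j 1)"
      using * by blast
    then show "Re (A $ i $ j) = Re (cnj (A $ j $ i))"
      by (simp add: inner_axis inner_axis' matrix_vector_mult_axis inner_complex_def)
    \<comment> \<open>The real inner product sees only real parts, so the imaginary part of an entry
      is read off with a basis vector multiplied by \<open>\<i>\<close>.\<close>
    have "inner (axis i 1) (A *v axis j \<i>) = inner (A *v axis i 1) (axis j \<i>)"
      using * by blast
    then show "Im (A $ i $ j) = Im (cnj (A $ j $ i))"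
      by (simp add: inner_axis inner_axis' matrix_vector_mult_axis inner_complex_def)
  qed
qed (simp add: hermitian_self_adjoint)

lemma hermitian_add: "hermitian A \<Longrightarrow> hermitian B \<Longrightarrow> hermitian (A + B)"
  unfolding hermitian_iff_self_adjoint
  by (simp add: matrix_vector_mult_add_rdistrib inner_add_left inner_add_right)

lemma hermitian_uminus: "hermitian A \<Longrightarrow> hermitian (- A)"
  unfolding hermitian_def by (metis complex_cnj_minus vector_uminus_component)

lemma hermitian_diag_mat: "hermitian (diag_mat y)"
  by (auto simp add: hermitian_def diag_mat_def)

lemma uminus_matrix_vector_mult: "(- A) *v v = - (A *v v)" for A :: "'a::ring_1^'n^'m"
  by (simp add: vec_eq_iff matrix_vector_mult_def sum_negf)

lemma scaleR_matrix_vector_mult: "(c *\<^sub>R A) *v v = c *\<^sub>R (A *v v)" for A :: "complex^'n^'m"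
  by (simp add: vec_eq_iff matrix_vector_mult_def scaleR_sum_right)

text \<open>This is where moments enter: a diagonal perturbation changes the quadratic form at
  \<open>v\<close> by a linear function of \<open>abs_sq v\<close>.\<close>

lemma diag_mat_quadratic_form: "inner v (diag_mat y *v v) = inner y (abs_sq v)"
proof -
  have "(diag_mat y *v v) $ i = complex_of_real (y $ i) * v $ i" for i
  proof -
    have "(diag_mat y *v v) $ i = (\<Sum>k\<in>UNIV. if k = i then complex_of_real (y $ i) * v $ i else 0)"
      unfolding matrix_vector_mult_def diag_mat_def vec_lambda_beta by (rule sum.cong) auto
    then show ?thesis by simp
  qed
  then show ?thesis
    unfolding inner_vec_def abs_sq_def vec_lambda_beta cmod_power2
    by (intro sum.cong) (auto simp: inner_complex_def power2_eq_square algebra_simps)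
qed

lemma inner_eigenvector: "A *v v = r *\<^sub>R v \<Longrightarrow> inner v (A *v v) = r * (norm v)\<^sup>2"
  by (simp add: power2_norm_eq_inner)

text \<open>First-order optimality: perturbing \<open>v\<close> along the residual \<open>m v - A v\<close> would otherwise make
  the nonnegative form \<open>u \<mapsto> m \<parallel>u\<parallel>\<^sup>2 - \<langle>u, A u\<rangle>\<close> negative.\<close>

lemma quadratic_form_maximizer_eigenvector:
  fixes A :: "complex^'n^'n"
  assumes A: "hermitian A"
    and le: "\<And>u. inner u (A *v u) \<le> m * (norm u)\<^sup>2"
    and eq: "inner v (A *v v) = m * (norm v)\<^sup>2"
  shows "A *v v = m *\<^sub>R v"
proof -
  define w where "w = m *\<^sub>R v - A *v v"
  define D where "D u = m * (norm u)\<^sup>2 - inner u (A *v u)" for u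
  have D0: "D u \<ge> 0" for u using le by (simp add: D_def)
  show ?thesis
  proof (rule ccontr)
    assume "A *v v \<noteq> m *\<^sub>R v"
    then have w0: "inner w w > 0" by (simp add: w_def)
    \<comment> \<open>The step is short enough for the linear gain to beat the quadratic term
      \<open>s\<^sup>2 * D w\<close>; the added 1 keeps the denominator positive when
      \<open>D w = 0\<close>.\<close>
    define s where "s = inner w w / (D w + 1)"
    have s: "s > 0" "s * D w < inner w w" using D0[of w] w0 by (auto simp: s_def field_simps)
    have vw: "inner v (A *v w) = inner w (A *v v)"
      using hermitian_self_adjoint[OF A, of v w] by (simp add: inner_commute)
    have "D (v - s *\<^sub>R w) = D v - 2 * s * (m * inner w v - inner w (A *v v)) + s\<^sup>2 * D w"
      unfolding D_def power2_norm_eq_inner matrix_vector_mult_diff_distrib linear_scale[OF matrix_vector_mul_linear]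
        inner_diff_left inner_diff_right inner_scaleR_left inner_scaleR_right vw inner_commute[of v w]
      by algebra
    also have "m * inner w v - inner w (A *v v) = inner w w"
      by (simp add: w_def inner_diff_right)
    also have "D v = 0" using eq by (simp add: D_def)
    finally have "2 * s * inner w w \<le> s\<^sup>2 * D w"
      using D0[of "v - s *\<^sub>R w"] by linarith
    then have "2 * inner w w \<le> s * D w"
      using s(1) by (simp add: power2_eq_square)
    then show False using s(2) w0 by linarith
  qed
qed

section \<open>Extremal eigenvalues and the spectral norm\<close>

text \<open>The form attains its maximum on the compact unit sphere, homogeneity of degree two
  extends the bound to all vectors, and a maximizer is an eigenvector.\<close>

lemma hermitian_top_eigenvector:
  fixes A :: "complex^'n^'n"
  assumes A: "hermitian A"
  shows "\<exists>v m. norm v = 1 \<and> A *v v = m *\<^sub>R v \<and> (\<forall>u. inner u (A *v u) \<le> m * (norm u)\<^sup>2)"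
proof -
  let ?q = "\<lambda>u. inner u (A *v u)"
  have ne: "sphere (0::complex^'n) 1 \<noteq> {}"
    by simp
  have "continuous_on (sphere 0 1) ?q"
    by (intro continuous_intros)
  then obtain v where v: "v \<in> sphere 0 1" and max: "\<And>u. u \<in> sphere 0 1 \<Longrightarrow> ?q u \<le> ?q v"
    using continuous_attains_sup[OF compact_sphere ne, of ?q] by blast
  have le: "?q u \<le> ?q v * (norm u)\<^sup>2" for u
  proof (cases "u = 0")
    case False
    have "?q (u /\<^sub>R norm u) \<le> ?q v"
      using False by (intro max) simp
    moreover have "?q (u /\<^sub>R norm u) = ?q u / (norm u)\<^sup>2"
      by (simp add: linear_scale[OF matrix_vector_mul_linear] power2_eq_square divide_inverse)
    ultimately have "?q u / (norm u)\<^sup>2 \<le> ?q v"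
      by simp
    then show ?thesis
      using False by (simp add: pos_divide_le_eq)
  qed simp
  have "A *v v = ?q v *\<^sub>R v"
    using quadratic_form_maximizer_eigenvector[OF A le] v by simp
  then show ?thesis
    using v le by (intro exI[of _ v] exI[of _ "?q v"]) simp
qed

text \<open>Eigenvectors for distinct real eigenvalues are orthogonal, hence independent, hence
  finitely many. This makes \<open>Max\<close> and \<open>Min\<close> in the definitions
  meaningful.\<close>

lemma finite_real_eigenvalues:
  fixes A :: "complex^'n^'n"
  assumes A: "hermitian A"
  shows "finite {l. complex_of_real l \<in> eigenvalues A}"
proof -
  let ?L = "{l. complex_of_real l \<in> eigenvalues A}"
  have "\<forall>l\<in>?L. \<exists>v. v \<noteq> 0 \<and> A *v v = l *\<^sub>R v"
    by (simp add: eigenvalues_def of_real_vector_scalar_mult)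
  then obtain e where e: "\<And>l. l \<in> ?L \<Longrightarrow> e l \<noteq> 0 \<and> A *v e l = l *\<^sub>R e l"
    by metis
  have orth: "inner (e k) (e l) = 0" if "k \<in> ?L" "l \<in> ?L" "k \<noteq> l" for k l
  proof -
    have "l * inner (e k) (e l) = k * inner (e k) (e l)"
      using hermitian_self_adjoint[OF A, of "e k" "e l"] e[OF that(1)] e[OF that(2)] by simp
    with that show ?thesis by simp
  qed
  have "inj_on e ?L"
  proof (rule inj_onI, rule ccontr)
    fix k l assume "k \<in> ?L" "l \<in> ?L" "e k = e l" "k \<noteq> l"
    then show False using orth[of k l] e[of l] by simp
  qed
  moreover have "pairwise orthogonal (e ` ?L)"
    using orth by (auto simp: pairwise_def orthogonal_def)
  then have "finite (e ` ?L)"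
    using e by (intro independent_imp_finite pairwise_orthogonal_independent) auto
  ultimately show ?thesis
    by (rule finite_imageD[rotated])
qed

lemma lambda_max_eq:
  fixes A :: "complex^'n^'n"
  assumes A: "hermitian A" and v: "v \<noteq> 0" "A *v v = m *\<^sub>R v"
    and le: "\<And>u. inner u (A *v u) \<le> m * (norm u)\<^sup>2"
  shows "lambda_max A = m"
  unfolding lambda_max_def
proof (rule Max_eqI[OF finite_real_eigenvalues[OF A]])
  show "m \<in> {l. complex_of_real l \<in> eigenvalues A}"
    using v by (auto simp: eigenvalues_def of_real_vector_scalar_mult)
  show "l \<le> m" if l: "l \<in> {l. complex_of_real l \<in> eigenvalues A}" for l
  proof -
    obtain u where u: "u \<noteq> 0" "A *v u = l *\<^sub>R u"
      using l by (auto simp: eigenvalues_def of_real_vector_scalar_mult)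
    then have "l * (norm u)\<^sup>2 \<le> m * (norm u)\<^sup>2"
      using le[of u] inner_eigenvector[OF u(2)] by linarith
    with u show ?thesis by simp
  qed
qed

lemma quadratic_form_le_lambda_max:
  assumes "hermitian A"
  shows "inner u (A *v u) \<le> lambda_max A * (norm u)\<^sup>2"
proof -
  obtain v m where "norm v = 1" "A *v v = m *\<^sub>R v" "\<And>u. inner u (A *v u) \<le> m * (norm u)\<^sup>2"
    using hermitian_top_eigenvector[OF assms] by metis
  moreover from this have "v \<noteq> 0" by auto
  ultimately show ?thesis
    using lambda_max_eq[OF assms] by simp
qed

lemma lambda_max_eigenvector:
  assumes "hermitian A"
  obtains v where "norm v = 1" "A *v v = lambda_max A *\<^sub>R v"
proof -
  obtain v m where v: "norm v = 1" "A *v v = m *\<^sub>R v" "\<And>u. inner u (A *v u) \<le> m * (norm u)\<^sup>2"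
    using hermitian_top_eigenvector[OF assms] by metis
  moreover from v have "v \<noteq> 0" by auto
  ultimately show ?thesis
    using lambda_max_eq[OF assms] that[of v] by simp
qed

lemma eigenspace_real: "eigenspace A (complex_of_real r) = {v. A *v v = r *\<^sub>R v}"
  by (simp add: eigenspace_def of_real_vector_scalar_mult)

text \<open>The top eigenspace is the equality case of the Rayleigh bound; later arguments use it
  only in this form.\<close>

lemma eigenspace_lambda_max_iff:
  assumes "hermitian A"
  shows "v \<in> eigenspace A (complex_of_real (lambda_max A)) \<longleftrightarrow>
    inner v (A *v v) = lambda_max A * (norm v)\<^sup>2"
  using quadratic_form_maximizer_eigenvector[OF assms quadratic_form_le_lambda_max[OF assms]]
    inner_eigenvector by (auto simp: eigenspace_real)

lemma eigenspace_uminus: "eigenspace (- A) (- l) = eigenspace A l"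
  by (simp add: eigenspace_def uminus_matrix_vector_mult vec.scale_minus_left)

text \<open>Passing to \<open>- A\<close> lets every later argument about the smallest eigenvalue be
  an instance of one about the largest.\<close>

lemma lambda_min_eq:
  assumes A: "hermitian A"
  shows "lambda_min A = - lambda_max (- A)"
proof -
  let ?L = "{l. complex_of_real l \<in> eigenvalues (- A)}"
  have *: "- l \<in> ?L \<longleftrightarrow> complex_of_real l \<in> eigenvalues A" for l
    by (simp add: eigenvalues_def of_real_vector_scalar_mult uminus_matrix_vector_mult vec.scale_minus_left)
  have "{l. complex_of_real l \<in> eigenvalues A} = uminus ` ?L"
  proof (intro set_eqI iffI)
    show "l \<in> uminus ` ?L" if "l \<in> {l. complex_of_real l \<in> eigenvalues A}" for l
      using that *[of l] by (intro image_eqI[of l uminus "- l"]) auto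
    show "l \<in> {l. complex_of_real l \<in> eigenvalues A}" if "l \<in> uminus ` ?L" for l
      using that *[of l] by auto
  qed
  moreover have "?L \<noteq> {}"
  proof -
    obtain v where "norm v = 1" "(- A) *v v = lambda_max (- A) *\<^sub>R v"
      using lambda_max_eigenvector[OF hermitian_uminus[OF A]] .
    then show ?thesis
      by (auto simp: eigenvalues_def of_real_vector_scalar_mult intro!: exI[of _ "lambda_max (- A)"] exI[of _ v])
  qed
  ultimately show ?thesis
    using minus_Max_eq_Min[OF finite_real_eigenvalues[OF hermitian_uminus[OF A]]]
    by (simp add: lambda_min_def lambda_max_def)
qed

text \<open>Polarization: \<open>4\<langle>u, B v\<rangle>\<close> is a difference of two values of the quadratic form, and \<open>u\<close> is taken
  parallel to \<open>B v\<close> with the length of \<open>v\<close>.\<close>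

lemma norm_le_quadratic_form_bound:
  fixes B :: "complex^'n^'n"
  assumes B: "hermitian B" and c: "\<And>u. \<bar>inner u (B *v u)\<bar> \<le> c * (norm u)\<^sup>2"
  shows "norm (B *v v) \<le> c * norm v"
proof (cases "B *v v = 0 \<or> v = 0")
  case True
  have "0 \<le> c * (norm v)\<^sup>2" using c[of v] by linarith
  then have "v \<noteq> 0 \<Longrightarrow> 0 \<le> c" by (simp add: zero_le_mult_iff not_le[symmetric])
  with True show ?thesis by (cases "v = 0") auto
next
  case False
  define u where "u = (norm v / norm (B *v v)) *\<^sub>R (B *v v)"
  have nu: "norm u = norm v" using False by (simp add: u_def)
  have "4 * inner u (B *v v) = inner (u + v) (B *v (u + v)) - inner (u - v) (B *v (u - v))"
    using hermitian_self_adjoint[OF B, of v u]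
    by (simp add: matrix_vector_right_distrib matrix_vector_mult_diff_distrib inner_add_left
        inner_add_right inner_diff_left inner_diff_right inner_commute)
  also have "\<dots> \<le> c * (norm (u + v))\<^sup>2 + c * (norm (u - v))\<^sup>2"
    using c[of "u + v"] c[of "u - v"] by linarith
  also have "\<dots> = c * (2 * (norm u)\<^sup>2 + 2 * (norm v)\<^sup>2)"
    by (simp add: power2_norm_eq_inner inner_add_left inner_add_right inner_diff_left
        inner_diff_right inner_commute algebra_simps)
  finally have "inner u (B *v v) \<le> c * (norm v)\<^sup>2"
    by (simp add: nu)
  moreover have "inner u (B *v v) = norm v * norm (B *v v)"
    using False by (simp add: u_def power2_norm_eq_inner[symmetric] power2_eq_square)
  ultimately show ?thesis
    using False by (simp add: power2_eq_square mult.left_commute)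
qed

text \<open>For a Hermitian matrix a bound on the absolute value of the form bounds the norm;
  conversely, a unit top eigenvector of \<open>B\<close> or of \<open>- B\<close> is stretched by at
  least its eigenvalue.\<close>

lemma spectral_norm_eq:
  assumes B: "hermitian B"
  shows "spectral_norm B = max (lambda_max B) (lambda_max (- B))"
proof (rule antisym)
  have "\<bar>inner u (B *v u)\<bar> \<le> max (lambda_max B) (lambda_max (- B)) * (norm u)\<^sup>2" for u
  proof -
    have "lambda_max B * (norm u)\<^sup>2 \<le> max (lambda_max B) (lambda_max (- B)) * (norm u)\<^sup>2"
      "lambda_max (- B) * (norm u)\<^sup>2 \<le> max (lambda_max B) (lambda_max (- B)) * (norm u)\<^sup>2"
      by (intro mult_right_mono; simp)+
    then show ?thesis
      using quadratic_form_le_lambda_max[OF B, of u]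
        quadratic_form_le_lambda_max[OF hermitian_uminus[OF B], of u]
      by (simp add: uminus_matrix_vector_mult)
  qed
  then show "spectral_norm B \<le> max (lambda_max B) (lambda_max (- B))"
    unfolding spectral_norm_def by (intro onorm_le norm_le_quadratic_form_bound[OF B])
  have *: "lambda_max C \<le> onorm ((*v) B)" if C: "hermitian C" and "C = B \<or> C = - B" for C
  proof -
    obtain v where v: "norm v = 1" "C *v v = lambda_max C *\<^sub>R v"
      using lambda_max_eigenvector[OF C] .
    have "lambda_max C \<le> norm (C *v v)" using v by simp
    also have "\<dots> = norm (B *v v)" using that by (auto simp: uminus_matrix_vector_mult)
    also have "\<dots> \<le> onorm ((*v) B)"
      using onorm[OF matrix_vector_mul_bounded_linear, of B v] v by simp
    finally show ?thesis .
  qed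
  show "max (lambda_max B) (lambda_max (- B)) \<le> spectral_norm B"
    unfolding spectral_norm_def using *[OF B] *[OF hermitian_uminus[OF B]] by simp
qed

section \<open>Moments\<close>

lemma abs_sq_scaleR: "abs_sq (c *\<^sub>R v) = c\<^sup>2 *\<^sub>R abs_sq v"
  by (simp add: abs_sq_def vec_eq_iff power_mult_distrib)

lemma sum_abs_sq: "(\<Sum>i\<in>UNIV. abs_sq v $ i) = (norm v)\<^sup>2"
  by (simp add: abs_sq_def norm_vec_def L2_set_def sum_nonneg)

lemma continuous_on_abs_sq: "continuous_on S abs_sq"
  unfolding abs_sq_def by (intro continuous_intros)

lemma convex_moment: "convex (moment S)"
  by (simp add: moment_def)

lemma abs_sq_in_moment: "v \<in> S \<Longrightarrow> norm v = 1 \<Longrightarrow> abs_sq v \<in> moment S"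
  unfolding moment_def by (rule hull_inc) auto

lemma compact_moment:
  assumes "closed S"
  shows "compact (moment S)"
proof -
  have "{abs_sq v | v. v \<in> S \<and> norm v = 1} = abs_sq ` (sphere 0 1 \<inter> S)"
    by auto
  then show ?thesis
    unfolding moment_def using assms
    by (simp add: compact_convex_hull compact_continuous_image continuous_on_abs_sq compact_Int_closed)
qed

text \<open>Moments lie in an affine hyperplane that misses the origin. This excludes 0, normalizes
  points of the cones, and lets a separating level be shifted to zero.\<close>

lemma sum_moment:
  assumes "m \<in> moment S"
  shows "(\<Sum>i\<in>UNIV. m $ i) = 1"
proof -
  have "convex {m :: real^'n. (\<Sum>i\<in>UNIV. m $ i) = 1}"
    by (auto simp: convex_def sum.distrib sum_distrib_left[symmetric])
  then have "moment S \<subseteq> {m. (\<Sum>i\<in>UNIV. m $ i) = 1}"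
    unfolding moment_def by (intro hull_minimal) (auto simp: sum_abs_sq)
  with assms show ?thesis
    by auto
qed

lemma subspace_eigenspace:
  fixes A :: "complex^'n^'n"
  shows "vec.subspace (eigenspace A l)"
  unfolding vec.subspace_def eigenspace_def
  by (auto simp: matrix_vector_right_distrib vec.scale_right_distrib
      vec.linear_scale[OF matrix_vector_mul_linear_gen] mult.commute)

lemma closed_eigenspace: "closed (eigenspace A l)"
  by (intro closed_subspace subspace_imp_real_subspace subspace_eigenspace)

section \<open>Orthogonal projections\<close>

lemma inner_complex_scale_left: "inner (c *s u) v = inner u (cnj c *s v)"
  by (simp add: inner_complex_vec mult.left_commute mult.assoc)

text \<open>The real orthogonal decomposition defines a map \<open>p\<close>, and uniqueness of the
  decomposition makes it additive. Since \<open>S\<close> is closed under complex scalars,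
  \<open>cnj c *s w\<close> may replace \<open>w\<close> in the orthogonality relations, so
  \<open>p\<close> is complex linear and given by a matrix.\<close>

lemma orth_proj_exists:
  fixes S :: "(complex^'n) set"
  assumes S: "vec.subspace S"
  shows "\<exists>P. hermitian P \<and> P ** P = P \<and> range (\<lambda>v. P *v v) = S"
proof -
  have span: "span S = S"
    using subspace_imp_real_subspace[OF S] by (simp add: span_eq_iff)
  have "\<exists>y. y \<in> S \<and> (\<forall>w\<in>S. inner (v - y) w = 0)" for v
  proof -
    obtain y z where "y \<in> span S" "\<And>w. w \<in> span S \<Longrightarrow> orthogonal z w" "v = y + z"
      using orthogonal_subspace_decomp_exists[of S v] by blast
    then show ?thesis
      by (intro exI[of _ y]) (auto simp: span orthogonal_def)
  qed
  then obtain p where p: "\<And>v. p v \<in> S" "\<And>v w. w \<in> S \<Longrightarrow> inner (v - p v) w = 0"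
    by metis
  have unique: "p v = y" if "y \<in> S" "\<And>w. w \<in> S \<Longrightarrow> inner (v - y) w = 0" for v y
  proof -
    have d: "p v - y \<in> S"
      using vec.subspace_diff[OF S p(1) that(1)] .
    have "inner (p v - y) (p v - y) = inner (v - y) (p v - y) - inner (v - p v) (p v - y)"
      by (simp add: inner_diff_left)
    then show ?thesis
      using that(2)[OF d] p(2)[OF d] by simp
  qed
  have add: "p (u + v) = p u + p v" for u v
  proof (rule unique)
    show "p u + p v \<in> S" using vec.subspace_add[OF S p(1) p(1)] .
    show "inner (u + v - (p u + p v)) w = 0" if "w \<in> S" for w
      using p(2)[OF that, of u] p(2)[OF that, of v] by (simp add: inner_diff_left inner_add_left)
  qed
  have scale: "p (c *s v) = c *s p v" for c v
  proof (rule unique)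
    show "c *s p v \<in> S" using vec.subspace_scale[OF S p(1)] .
    show "inner (c *s v - c *s p v) w = 0" if "w \<in> S" for w
      using p(2)[OF vec.subspace_scale[OF S that], of v "cnj c"]
      by (simp add: inner_complex_scale_left inner_diff_left)
  qed
  have "Vector_Spaces.linear (*s) (*s) p"
    unfolding Vector_Spaces.linear_iff using add scale by (simp add: vec.vector_space_axioms)
  then have P: "matrix p *v v = p v" for v
    by (rule matrix_works)
  have id: "p v = v" if "v \<in> S" for v
    using that by (intro unique) auto
  have "inner u (p v) = inner (p u) v" for u v
    using p(2)[OF p(1), of u v] p(2)[OF p(1), of v u]
    by (simp add: inner_diff_left inner_commute[of v "p u"] inner_commute[of "p v" "p u"])
  then have "hermitian (matrix p)"
    by (simp add: hermitian_iff_self_adjoint P)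
  moreover have "matrix p ** matrix p = matrix p"
    by (simp add: matrix_eq P id p(1) flip: matrix_vector_mul_assoc)
  moreover have "range (\<lambda>v. matrix p *v v) = S"
    using p(1) id by (auto simp: P image_iff) metis
  ultimately show ?thesis by blast
qed

text \<open>Each matrix fixes the common range, so \<open>Q ** P = P\<close> and
  \<open>P ** Q = Q\<close>; the adjoint of the first identity is \<open>P ** Q = P\<close>.\<close>

lemma orthogonal_projection_unique:
  fixes P Q :: "complex^'n^'n"
  assumes P: "hermitian P" "P ** P = P" and Q: "hermitian Q" "Q ** Q = Q"
    and range: "range (\<lambda>v. P *v v) = range (\<lambda>v. Q *v v)"
  shows "P = Q"
proof -
  have QP: "Q *v (P *v v) = P *v v" for v
  proof -
    obtain u where "P *v v = Q *v u" using range by blast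
    then show ?thesis by (simp add: matrix_vector_mul_assoc Q)
  qed
  have PQ: "P *v (Q *v v) = Q *v v" for v
  proof -
    obtain u where "Q *v v = P *v u" using range by blast
    then show ?thesis by (simp add: matrix_vector_mul_assoc P)
  qed
  have "inner u (P *v v) = inner u (Q *v v)" for u v
  proof -
    have "inner u (P *v v) = inner (P *v (Q *v u)) v"
      using hermitian_self_adjoint[OF Q(1), of u "P *v v"] hermitian_self_adjoint[OF P(1), of "Q *v u" v]
      by (simp add: QP)
    then show ?thesis
      using hermitian_self_adjoint[OF Q(1), of u v] by (simp add: PQ)
  qed
  then show ?thesis
    by (metis matrix_eq vector_eq_ldot)
qed

lemma orth_proj:
  fixes S :: "(complex^'n) set"
  assumes "vec.subspace S"
  shows hermitian_orth_proj: "hermitian (orth_proj S)"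
    and orth_proj_idem: "orth_proj S ** orth_proj S = orth_proj S"
    and range_orth_proj: "range (\<lambda>v. orth_proj S *v v) = S"
proof -
  have "\<exists>!P. hermitian P \<and> P ** P = P \<and> range (\<lambda>v. P *v v) = S"
    using orth_proj_exists[OF assms] orthogonal_projection_unique by (metis (no_types, lifting))
  from theI'[OF this]
  show "hermitian (orth_proj S)" "orth_proj S ** orth_proj S = orth_proj S"
    "range (\<lambda>v. orth_proj S *v v) = S"
    by (simp_all add: orth_proj_def)
qed

lemma orth_proj_fixes:
  assumes "vec.subspace S" "v \<in> S"
  shows "orth_proj S *v v = v"
proof -
  obtain u where "v = orth_proj S *v u"
    using range_orth_proj[OF assms(1)] assms(2) by blast
  then show ?thesis
    by (simp add: matrix_vector_mul_assoc orth_proj_idem[OF assms(1)])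
qed

section \<open>First-order behaviour of the largest eigenvalue\<close>

text \<open>A unit top eigenvector \<open>v\<close> of \<open>B\<close> is a test vector for the
  perturbed form, where it yields \<open>lambda_max B + inner h (abs_sq v)\<close>. The resulting
  inequality is linear in \<open>abs_sq v\<close> and passes to the convex hull.\<close>

lemma lambda_max_subgradient:
  fixes B :: "complex^'n^'n"
  assumes B: "hermitian B" and m: "m \<in> moment (eigenspace B (complex_of_real (lambda_max B)))"
  shows "lambda_max B + inner m h \<le> lambda_max (B + diag_mat h)"
proof -
  let ?E = "eigenspace B (complex_of_real (lambda_max B))"
  let ?H = "{m. inner h m \<le> lambda_max (B + diag_mat h) - lambda_max B}"
  have "moment ?E \<subseteq> ?H"
    unfolding moment_def
  proof (rule hull_minimal[of _ ?H convex, OF _ convex_halfspace_le], safe)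
    fix v assume v: "v \<in> ?E" "norm v = 1"
    have "lambda_max B + inner h (abs_sq v) = inner v ((B + diag_mat h) *v v)"
      using v eigenspace_lambda_max_iff[OF B]
      by (simp add: matrix_vector_mult_add_rdistrib inner_add_right diag_mat_quadratic_form)
    also have "\<dots> \<le> lambda_max (B + diag_mat h)"
      using quadratic_form_le_lambda_max[OF hermitian_add[OF B hermitian_diag_mat], of v h] v by simp
    finally show "inner h (abs_sq v) \<le> lambda_max (B + diag_mat h) - lambda_max B" by simp
  qed
  with m show ?thesis by (auto simp: inner_commute)
qed

text \<open>On the compact set of unit vectors violating the slope bound, the unperturbed form stays below
  its maximum by a fixed gap, which a small perturbation cannot close.\<close>

lemma lambda_max_directional_bound:
  fixes B :: "complex^'n^'n"
  assumes B: "hermitian B"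
    and less: "\<And>v. v \<in> eigenspace B (complex_of_real (lambda_max B)) \<Longrightarrow> norm v = 1 \<Longrightarrow>
      inner h (abs_sq v) < w"
  shows "\<exists>d>0. \<forall>t. 0 < t \<longrightarrow> t < d \<longrightarrow>
    lambda_max (B + diag_mat (t *\<^sub>R h)) < lambda_max B + t * w"
proof -
  define q where "q v = inner v (B *v v)" for v
  have q_cont: "continuous_on X q" for X
    unfolding q_def by (intro continuous_intros)
  have a_cont: "continuous_on X (\<lambda>v. inner h (abs_sq v))" for X
    by (intro continuous_intros continuous_on_abs_sq)
  have q_le: "q v \<le> lambda_max B" if "norm v = 1" for v
    using quadratic_form_le_lambda_max[OF B, of v] that by (simp add: q_def)
  define K where "K = sphere 0 1 \<inter> {v. w \<le> inner h (abs_sq v)}"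
  have K: "compact K"
    unfolding K_def by (intro compact_Int_closed compact_sphere closed_Collect_le continuous_on_const a_cont)
  obtain e where e: "e > 0" "\<And>v. v \<in> K \<Longrightarrow> q v \<le> lambda_max B - e"
  proof (cases "K = {}")
    case False
    obtain v where v: "v \<in> K" "\<And>u. u \<in> K \<Longrightarrow> q u \<le> q v"
      using continuous_attains_sup[OF K False q_cont] by blast
    have "norm v = 1" using v(1) by (simp add: K_def)
    then have "q v \<noteq> lambda_max B"
      using less[of v] eigenspace_lambda_max_iff[OF B, of v] v(1) by (auto simp: q_def K_def)
    with q_le[OF \<open>norm v = 1\<close>] v(2) show thesis
      by (intro that[of "lambda_max B - q v"]) auto
  qed (use that[of 1] in auto)
  obtain M where M: "\<And>v. norm v = 1 \<Longrightarrow> inner h (abs_sq v) \<le> M"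
  proof -
    have "bounded ((\<lambda>v. inner h (abs_sq v)) ` sphere 0 1)"
      by (intro compact_imp_bounded compact_continuous_image a_cont) simp
    then show thesis
      using that unfolding bounded_iff by (fastforce simp: abs_le_iff)
  qed
  show ?thesis
  proof (intro exI conjI allI impI)
    \<comment> \<open>For unit vectors the perturbation exceeds \<open>t * w\<close> by at most
      \<open>t * \<bar>M - w\<bar>\<close>; this threshold keeps the excess below the gap
      \<open>e\<close> available on \<open>K\<close>.\<close>
    show "e / (\<bar>M - w\<bar> + 1) > 0" using e(1) by simp
    fix t assume t: "0 < t" "t < e / (\<bar>M - w\<bar> + 1)"
    then have te: "t * \<bar>M - w\<bar> + t < e" by (simp add: field_simps)
    have "t * (M - w) \<le> t * \<bar>M - w\<bar>" using t by simp
    with te t have tM: "t * M < t * w + e" by (simp add: algebra_simps)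
    have "hermitian (B + diag_mat (t *\<^sub>R h))"
      by (intro hermitian_add B hermitian_diag_mat)
    then obtain v where v: "norm v = 1"
      "(B + diag_mat (t *\<^sub>R h)) *v v = lambda_max (B + diag_mat (t *\<^sub>R h)) *\<^sub>R v"
      by (rule lambda_max_eigenvector)
    have eq: "lambda_max (B + diag_mat (t *\<^sub>R h)) = q v + t * inner h (abs_sq v)"
      using inner_eigenvector[OF v(2)] v(1)
      by (simp add: matrix_vector_mult_add_rdistrib inner_add_right diag_mat_quadratic_form q_def)
    show "lambda_max (B + diag_mat (t *\<^sub>R h)) < lambda_max B + t * w"
    proof (cases "v \<in> K")
      case True
      have "t * inner h (abs_sq v) \<le> t * M" using M[OF v(1)] t by simp
      with e(2)[OF True] tM eq show ?thesis by linarith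
    next
      case False
      then have "t * inner h (abs_sq v) < t * w" using v(1) t by (simp add: K_def)
      with q_le[OF v(1)] eq show ?thesis by linarith
    qed
  qed
qed

section \<open>Joint numerical ranges of compressed bases\<close>

lemma hermitian_scaleR: "hermitian A \<Longrightarrow> hermitian (c *\<^sub>R A)"
  by (simp add: hermitian_iff_self_adjoint scaleR_matrix_vector_mult)

lemma psd_add: "psd A \<Longrightarrow> psd B \<Longrightarrow> psd (A + B)"
  by (simp add: psd_def hermitian_add matrix_vector_mult_add_rdistrib inner_add_right)

lemma psd_scaleR: "psd A \<Longrightarrow> 0 \<le> c \<Longrightarrow> psd (c *\<^sub>R A)"
  by (simp add: psd_def hermitian_scaleR scaleR_matrix_vector_mult)

lemma psd_compression:
  fixes P Q :: "complex^'n^'n"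
  assumes "hermitian P" "psd Q"
  shows "psd (P ** Q ** P)"
proof -
  have Q: "hermitian Q" "\<And>v. 0 \<le> inner v (Q *v v)"
    using assms(2) by (auto simp: psd_def)
  have "inner u ((P ** Q ** P) *v v) = inner (P *v u) (Q *v (P *v v))" for u v
    by (simp add: hermitian_self_adjoint[OF assms(1)] flip: matrix_vector_mul_assoc)
  moreover have "inner ((P ** Q ** P) *v u) v = inner (P *v u) (Q *v (P *v v))" for u v
    by (simp add: hermitian_self_adjoint[OF assms(1), symmetric] hermitian_self_adjoint[OF Q(1)]
        flip: matrix_vector_mul_assoc)
  ultimately show ?thesis
    using Q(2) by (simp add: psd_def hermitian_iff_self_adjoint)
qed

lemma psd_diagonal:
  assumes "psd Q"
  shows "0 \<le> Re (Q $ i $ i)" and "complex_of_real (Re (Q $ i $ i)) = Q $ i $ i"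
proof -
  have "0 \<le> inner (axis i 1) (Q *v axis i 1)"
    using assms by (simp only: psd_def)
  then show "0 \<le> Re (Q $ i $ i)"
    by (simp add: inner_axis' matrix_vector_mult_axis inner_complex_def)
  have "Q $ i $ i = cnj (Q $ i $ i)"
    using assms unfolding psd_def hermitian_def by blast
  then show "complex_of_real (Re (Q $ i $ i)) = Q $ i $ i"
    by (simp add: complex_eq_iff)
qed

lemma outer_mult_vector: "outer v *v u = (\<Sum>j\<in>UNIV. cnj (v $ j) * u $ j) *s v"
  by (simp add: vec_eq_iff outer_def matrix_vector_mult_def sum_distrib_left mult.commute mult.left_commute)

lemma psd_outer: "psd (outer v)"
  unfolding psd_def
proof
  show "hermitian (outer v)"
    by (simp add: hermitian_def outer_def mult.commute)
  have "inner u (outer v *v u) = (cmod (\<Sum>j\<in>UNIV. cnj (v $ j) * u $ j))\<^sup>2" for u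
  proof -
    let ?c = "\<Sum>j\<in>UNIV. cnj (v $ j) * u $ j"
    have "inner u (outer v *v u) = Re (?c * cnj ?c)"
      unfolding outer_mult_vector inner_complex_vec
      by (simp add: sum_distrib_left mult.commute mult.left_commute flip: Re_sum)
    then show ?thesis
      by (simp only: complex_norm_square[symmetric] Re_complex_of_real)
  qed
  then show "\<forall>u. 0 \<le> inner u (outer v *v u)"
    by simp
qed

lemma outer_diagonal: "outer v $ i $ i = complex_of_real (abs_sq v $ i)"
  by (simp add: outer_def abs_sq_def complex_norm_square[symmetric] del: of_real_power)

lemma trace_outer: "trace (outer v) = complex_of_real ((norm v)\<^sup>2)"
  unfolding trace_def outer_diagonal by (simp add: sum_abs_sq flip: of_real_sum)

lemma hermitian_compression_outer:
  fixes P :: "complex^'n^'n"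
  assumes P: "hermitian P"
  shows "P ** outer v ** P = outer (P *v v)"
proof -
  have 1: "(P ** outer v) $ i $ k = (P *v v) $ i * cnj (v $ k)" for i k
    by (simp add: matrix_matrix_mult_def outer_def matrix_vector_mult_def sum_distrib_right mult.assoc)
  have 2: "P $ k $ j = cnj (P $ j $ k)" for j k
    using P unfolding hermitian_def by blast
  have "(P ** outer v ** P) $ i $ j = (P *v v) $ i * cnj ((P *v v) $ j)" for i j
  proof -
    have "(P ** outer v ** P) $ i $ j = (\<Sum>k\<in>UNIV. (P *v v) $ i * cnj (v $ k) * P $ k $ j)"
      unfolding matrix_matrix_mult_def[of "P ** outer v"] vec_lambda_beta 1 ..
    also have "\<dots> = (\<Sum>k\<in>UNIV. (P *v v) $ i * cnj (P $ j $ k * v $ k))"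
      by (rule sum.cong, rule refl, subst 2, simp)
    also have "\<dots> = (P *v v) $ i * cnj ((P *v v) $ j)"
      unfolding matrix_vector_mult_def[of P v] vec_lambda_beta cnj_sum sum_distrib_left ..
    finally show ?thesis .
  qed
  then show ?thesis
    by (simp add: vec_eq_iff outer_def)
qed

lemma trace_mult_outer_axis: "trace (M ** outer (axis i 1)) = M $ i $ i"
proof -
  have "(M ** outer (axis i 1)) $ j $ j = (if j = i then M $ i $ i else 0)" for j
  proof -
    have "(M ** outer (axis i 1)) $ j $ j =
        (\<Sum>k\<in>UNIV. if k = i then (if j = i then M $ i $ i else 0) else 0)"
      unfolding matrix_matrix_mult_def outer_def axis_def vec_lambda_beta
      by (rule sum.cong) auto
    then show ?thesis by simp
  qed
  then show ?thesis
    by (simp add: trace_def)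
qed

text \<open>Cyclicity of the trace moves the projections from the basis matrix onto the state, and
  the remaining rank-one factor picks out a diagonal entry.\<close>

lemma joint_numerical_range_compressed_basis:
  "joint_numerical_range (compressed_basis S) =
    {\<chi> i. (orth_proj S ** \<rho> ** orth_proj S) $ i $ i | \<rho>. psd \<rho> \<and> trace \<rho> = 1}"
proof -
  have "trace (\<rho> ** compressed_basis S i) = (orth_proj S ** \<rho> ** orth_proj S) $ i $ i" for \<rho> i
  proof -
    have "trace (\<rho> ** compressed_basis S i) =
        trace ((\<rho> ** orth_proj S ** outer (axis i 1)) ** orth_proj S)"
      by (simp add: compressed_basis_def matrix_mul_assoc)
    also have "\<dots> = trace (orth_proj S ** \<rho> ** orth_proj S ** outer (axis i 1))"
      by (subst trace_mul_sym) (simp add: matrix_mul_assoc)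
    finally show ?thesis
      by (simp add: trace_mult_outer_axis)
  qed
  then show ?thesis
    by (simp add: joint_numerical_range_def)
qed

lemma moment_of_real_nonzero:
  assumes "m \<in> moment S"
  shows "(\<chi> i. complex_of_real (m $ i)) \<noteq> 0"
proof
  assume "(\<chi> i. complex_of_real (m $ i)) = 0"
  then have "m = 0" by (simp add: vec_eq_iff)
  then show False using sum_moment[OF assms] by simp
qed

text \<open>For a unit vector \<open>v\<close> in \<open>S\<close> the state \<open>outer v\<close>
  is unchanged by compression and has diagonal \<open>abs_sq v\<close>. Compression is linear in the
  state, so convex combinations follow.\<close>

lemma moment_in_joint_numerical_range:
  fixes S :: "(complex^'n) set"
  assumes S: "vec.subspace S" and m: "m \<in> moment S"
  shows "(\<chi> i. complex_of_real (m $ i)) \<in> joint_numerical_range (compressed_basis S)"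
proof -
  let ?P = "orth_proj S"
  let ?W = "joint_numerical_range (compressed_basis S)"
  have lin: "(?P ** (a *\<^sub>R \<rho> + b *\<^sub>R \<sigma>) ** ?P) $ i $ i =
      a *\<^sub>R (?P ** \<rho> ** ?P) $ i $ i + b *\<^sub>R (?P ** \<sigma> ** ?P) $ i $ i" for a b \<rho> \<sigma> i
    unfolding matrix_matrix_mult_def vec_lambda_beta vector_add_component vector_scaleR_component
    unfolding scaleR_conv_of_real
    by (simp add: ring_distribs sum.distrib sum_distrib_left sum_distrib_right mult_ac)
  have "convex {m. (\<chi> i. complex_of_real (m $ i)) \<in> ?W}"
  proof (rule convexI, unfold mem_Collect_eq)
    fix k l :: "real^'n" and a b :: real
    assume "(\<chi> i. complex_of_real (k $ i)) \<in> ?W" "(\<chi> i. complex_of_real (l $ i)) \<in> ?W"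
      and ab: "0 \<le> a" "0 \<le> b" "a + b = 1"
    then obtain \<rho> \<sigma> where \<rho>: "psd \<rho>" "trace \<rho> = 1" "\<And>i. complex_of_real (k $ i) = (?P ** \<rho> ** ?P) $ i $ i"
      and \<sigma>: "psd \<sigma>" "trace \<sigma> = 1" "\<And>i. complex_of_real (l $ i) = (?P ** \<sigma> ** ?P) $ i $ i"
      unfolding joint_numerical_range_compressed_basis by (auto simp: vec_eq_iff)
    have "psd (a *\<^sub>R \<rho> + b *\<^sub>R \<sigma>)"
      using \<rho> \<sigma> ab by (simp add: psd_add psd_scaleR)
    moreover have "trace (a *\<^sub>R \<rho> + b *\<^sub>R \<sigma>) = a *\<^sub>R trace \<rho> + b *\<^sub>R trace \<sigma>"
      by (simp add: trace_def sum.distrib scaleR_sum_right)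
    then have "trace (a *\<^sub>R \<rho> + b *\<^sub>R \<sigma>) = 1"
      using \<rho>(2) \<sigma>(2) ab(3) by (simp add: scaleR_conv_of_real flip: of_real_add)
    moreover have "(\<chi> i. complex_of_real ((a *\<^sub>R k + b *\<^sub>R l) $ i)) =
        (\<chi> i. (?P ** (a *\<^sub>R \<rho> + b *\<^sub>R \<sigma>) ** ?P) $ i $ i)"
      unfolding lin by (simp add: vec_eq_iff flip: \<rho>(3) \<sigma>(3)) (simp add: scaleR_conv_of_real)
    ultimately show "(\<chi> i. complex_of_real ((a *\<^sub>R k + b *\<^sub>R l) $ i)) \<in> ?W"
      unfolding joint_numerical_range_compressed_basis by blast
  qed
  then have "moment S \<subseteq> {m. (\<chi> i. complex_of_real (m $ i)) \<in> ?W}"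
    unfolding moment_def
  proof (rule hull_minimal[rotated], safe)
    fix v assume v: "v \<in> S" "norm v = 1"
    have "(\<chi> i. complex_of_real (abs_sq v $ i)) = (\<chi> i. (?P ** outer v ** ?P) $ i $ i)"
      using v S by (simp add: hermitian_compression_outer hermitian_orth_proj orth_proj_fixes outer_diagonal)
    moreover have "trace (outer v) = 1"
      using v by (simp add: trace_outer)
    ultimately show "(\<chi> i. complex_of_real (abs_sq v $ i)) \<in> ?W"
      unfolding joint_numerical_range_compressed_basis using psd_outer by blast
  qed
  with m show ?thesis by blast
qed

text \<open>A unit vector killed by the projection gives a rank-one state whose compression
  vanishes.\<close>

lemma zero_in_joint_numerical_range:
  fixes S :: "(complex^'n) set"
  assumes S: "vec.subspace S" and "S \<noteq> UNIV"
  shows "0 \<in> joint_numerical_range (compressed_basis S)"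
proof -
  let ?P = "orth_proj S"
  obtain v where v: "v \<notin> S" using assms(2) by blast
  define u where "u = v - ?P *v v"
  have "?P *v v \<in> S" using range_orth_proj[OF S] by blast
  with v have u: "u \<noteq> 0" by (auto simp: u_def)
  have Pu: "?P *v u = 0"
    by (simp add: u_def matrix_vector_mult_diff_distrib matrix_vector_mul_assoc orth_proj_idem[OF S])
  define w where "w = u /\<^sub>R norm u"
  have w: "norm w = 1" "?P *v w = 0"
    using u Pu by (simp_all add: w_def linear_scale[OF matrix_vector_mul_linear])
  have "(\<chi> i. (?P ** outer w ** ?P) $ i $ i) = 0"
    unfolding hermitian_compression_outer[OF hermitian_orth_proj[OF S]] w(2)
    by (simp add: vec_eq_iff outer_def)
  moreover have "trace (outer w) = 1"
    using w by (simp add: trace_outer)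
  ultimately show ?thesis
    unfolding joint_numerical_range_compressed_basis using psd_outer[of w]
    by (intro CollectI exI[of _ "outer w"]) simp
qed

text \<open>Normalize \<open>v\<close> and use that \<open>abs_sq\<close> is homogeneous of degree
  two. For \<open>v = 0\<close>, the cone hull contains 0 because the moment is nonempty.\<close>

lemma abs_sq_in_cone_moment:
  assumes S: "vec.subspace S" and ne: "moment S \<noteq> {}" and v: "v \<in> S"
  shows "abs_sq v \<in> cone hull (moment S)"
proof (cases "v = 0")
  case True
  then have "abs_sq v = 0" by (simp add: abs_sq_def vec_eq_iff)
  then show ?thesis using ne cone_hull_contains_0 by metis
next
  case False
  have "v /\<^sub>R norm v \<in> S"
    using subspace_scale[OF subspace_imp_real_subspace[OF S] v] .
  then have "abs_sq (v /\<^sub>R norm v) \<in> moment S"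
    using False by (intro abs_sq_in_moment) auto
  then have "(norm v)\<^sup>2 *\<^sub>R abs_sq (v /\<^sub>R norm v) \<in> cone hull (moment S)"
    by (intro mem_cone_hull) auto
  then show ?thesis
    using False by (simp add: abs_sq_scaleR power_divide divide_inverse[symmetric] power_inverse)
qed

text \<open>Symmetric Gaussian elimination: subtracting \<open>v v*\<close> with \<open>v = Q e\<^sub>i / \<surd>Q\<^sub>i\<^sub>i\<close> keeps \<open>Q\<close>
  positive semidefinite with range in \<open>S\<close> and clears the \<open>i\<close>-th diagonal entry.\<close>

lemma psd_diagonal_in_cone_moment:
  fixes Q :: "complex^'n^'n"
  assumes S: "vec.subspace S" and ne: "moment S \<noteq> {}"
    and "psd Q" "\<And>u. Q *v u \<in> S"
  shows "(\<chi> i. Re (Q $ i $ i)) \<in> cone hull (moment S)"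
  using assms(3,4)
proof (induction "card {i. Q $ i $ i \<noteq> 0}" arbitrary: Q rule: less_induct)
  case less
  show ?case
  proof (cases "\<forall>i. Q $ i $ i = 0")
    case True
    then have "(\<chi> i. Re (Q $ i $ i)) = 0" by (simp add: vec_eq_iff)
    then show ?thesis using ne cone_hull_contains_0 by metis
  next
    case False
    then obtain i where i: "Q $ i $ i \<noteq> 0" by blast
    define a where "a = Re (Q $ i $ i)"
    have Qii: "Q $ i $ i = complex_of_real a"
      using psd_diagonal(2)[OF less.prems(1)] by (simp add: a_def)
    have "a \<noteq> 0" using i Qii by auto
    moreover have "a \<ge> 0"
      unfolding a_def by (rule psd_diagonal(1)[OF less.prems(1)])
    ultimately have a: "a > 0" by simp
    define v where "v = (1 / sqrt a) *\<^sub>R (Q *v axis i 1)"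
    have vj: "v $ j = Q $ j $ i / complex_of_real (sqrt a)" for j
      unfolding v_def vector_scaleR_component matrix_vector_mult_axis
      unfolding scaleR_conv_of_real
      using a by (simp add: field_simps)
    have vS: "v \<in> S"
      unfolding v_def
      using subspace_scale[OF subspace_imp_real_subspace[OF S] less.prems(2)] .
    define R where "R = Q - outer v"
    have herm: "cnj (Q $ j $ k) = Q $ k $ j" for j k
    proof -
      have "Q $ k $ j = cnj (Q $ j $ k)"
        using less.prems(1) unfolding psd_def hermitian_def by blast
      then show ?thesis by simp
    qed
    \<comment> \<open>Writing \<open>R *v u\<close> as a value of \<open>Q\<close> keeps the range
      in \<open>S\<close> and prepares the proof of positivity.\<close>
    have Ru: "R *v u = Q *v (u - ((Q *v u) $ i / complex_of_real a) *s axis i 1)" for u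
    proof -
      have "(\<Sum>j\<in>UNIV. cnj (v $ j) * u $ j) = (Q *v u) $ i / complex_of_real (sqrt a)"
        by (simp add: vj herm matrix_vector_mult_def sum_divide_distrib)
      moreover have "v = (1 / complex_of_real (sqrt a)) *s (Q *v axis i 1)"
        by (simp add: vec_eq_iff vj matrix_vector_mult_axis)
      moreover have "complex_of_real (sqrt a) * complex_of_real (sqrt a) = complex_of_real a"
        using a by (simp flip: of_real_mult)
      ultimately have "outer v *v u = ((Q *v u) $ i / complex_of_real a) *s (Q *v axis i 1)"
        by (simp add: outer_mult_vector)
      then show ?thesis
        by (simp add: R_def matrix_vector_mult_diff_rdistrib matrix_vector_mult_diff_distrib
            vec.linear_scale[OF matrix_vector_mul_linear_gen])
    qed
    have hR: "hermitian R"
      using hermitian_add[of Q "- outer v"] hermitian_uminus[of "outer v"] psd_outer[of v] less.prems(1)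
      by (simp add: R_def psd_def)
    have "0 \<le> inner u (R *v u)" for u
    proof -
      \<comment> \<open>This \<open>c\<close> makes the \<open>i\<close>-th entry of
        \<open>Q *v ?u\<close> vanish, so the form of \<open>R\<close> at \<open>u\<close> equals
        the form of \<open>Q\<close> at \<open>?u\<close>.\<close>
      define c where "c = (Q *v u) $ i / complex_of_real a"
      let ?u = "u - c *s axis i 1"
      have "(Q *v ?u) $ i = 0"
        using a by (simp add: matrix_vector_mult_diff_distrib matrix_vector_mult_axis Qii c_def
            vec.linear_scale[OF matrix_vector_mul_linear_gen])
      then have "inner (c *s axis i 1) (Q *v ?u) = 0"
        by (simp add: inner_complex_scale_left inner_axis')
      then have "inner u (Q *v ?u) = inner ?u (Q *v ?u)"
        by (simp add: inner_diff_left)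
      also have "\<dots> \<ge> 0"
        using less.prems(1) by (simp add: psd_def)
      finally show ?thesis
        by (simp add: Ru c_def)
    qed
    with hR have R: "psd R" by (simp add: psd_def)
    have diag: "Re (Q $ j $ j) = abs_sq v $ j + Re (R $ j $ j)" for j
      by (simp add: R_def outer_diagonal)
    have "Re (R $ i $ i) = 0"
      using diag[of i] a by (simp add: abs_sq_def vj Qii norm_divide power_divide power2_eq_square)
    then have Ri: "R $ i $ i = 0"
      using psd_diagonal(2)[OF R, of i] by simp
    \<comment> \<open>Diagonal entries of \<open>Q\<close> split into two nonnegative summands, so
      zeros persist; as entry \<open>i\<close> is newly cleared, the number of nonzero entries
      drops.\<close>
    have "R $ j $ j = 0" if "Q $ j $ j = 0" for j
    proof -
      have "0 \<le> abs_sq v $ j" by (simp add: abs_sq_def)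
      then have "Re (R $ j $ j) \<le> 0"
        using diag[of j] that by simp
      then have "Re (R $ j $ j) = 0"
        using psd_diagonal(1)[OF R, of j] by simp
      then show ?thesis
        using psd_diagonal(2)[OF R, of j] by simp
    qed
    then have "{j. R $ j $ j \<noteq> 0} \<subset> {j. Q $ j $ j \<noteq> 0}"
      using Ri i by blast
    then have "card {j. R $ j $ j \<noteq> 0} < card {j. Q $ j $ j \<noteq> 0}"
      by (intro psubset_card_mono) auto
    then have "(\<chi> j. Re (R $ j $ j)) \<in> cone hull (moment S)"
      by (rule less.hyps[OF _ R]) (simp add: Ru less.prems(2))
    moreover have "abs_sq v \<in> cone hull (moment S)"
      using abs_sq_in_cone_moment[OF S ne vS] .
    moreover have "(\<chi> j. Re (Q $ j $ j)) = abs_sq v + (\<chi> j. Re (R $ j $ j))"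
      by (simp add: vec_eq_iff diag)
    ultimately show ?thesis
      using convex_cone[of "cone hull (moment S)"] convex_cone_hull[OF convex_moment[of S]]
        cone_cone_hull[of "moment S"] by simp
  qed
qed

text \<open>The compressed state is positive semidefinite with range in \<open>S\<close>, so its
  diagonal falls under the elimination argument.\<close>

lemma joint_numerical_range_in_cone_moment:
  fixes S :: "(complex^'n) set"
  assumes S: "vec.subspace S" and ne: "moment S \<noteq> {}"
    and z: "z \<in> joint_numerical_range (compressed_basis S)"
  shows "\<exists>r \<in> cone hull (moment S). z = (\<chi> i. complex_of_real (r $ i))"
proof -
  let ?P = "orth_proj S"
  obtain \<rho> where \<rho>: "psd \<rho>" and z: "z = (\<chi> i. (?P ** \<rho> ** ?P) $ i $ i)"
    using z unfolding joint_numerical_range_compressed_basis by blast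
  have psd: "psd (?P ** \<rho> ** ?P)"
    using psd_compression[OF hermitian_orth_proj[OF S] \<rho>] .
  have "(?P ** \<rho> ** ?P) *v u \<in> S" for u
    unfolding matrix_vector_mul_assoc[symmetric] using range_orth_proj[OF S] by blast
  then have "(\<chi> i. Re ((?P ** \<rho> ** ?P) $ i $ i)) \<in> cone hull (moment S)"
    by (intro psd_diagonal_in_cone_moment S ne psd)
  then show ?thesis
    by (rule rev_bexI) (simp add: z psd_diagonal(2)[OF psd])
qed

text \<open>Nonzero points of the two cones over the moments can be rescaled to coordinate sum one.\<close>

lemma cone_moments_inter:
  assumes "r \<in> cone hull (moment S)" "r \<in> cone hull (moment T)" "r \<noteq> 0"
  shows "moment S \<inter> moment T \<noteq> {}"
proof -
  obtain a m where m: "m \<in> moment S" "r = a *\<^sub>R m"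
    using assms(1) unfolding cone_hull_expl by blast
  obtain b k where k: "k \<in> moment T" "r = b *\<^sub>R k"
    using assms(2) unfolding cone_hull_expl by blast
  have "(\<Sum>i\<in>UNIV. r $ i) = a"
    unfolding m(2) using sum_moment[OF m(1)] by (simp flip: sum_distrib_left)
  moreover have "(\<Sum>i\<in>UNIV. r $ i) = b"
    unfolding k(2) using sum_moment[OF k(1)] by (simp flip: sum_distrib_left)
  ultimately have "a = b" by simp
  with m k assms(3) have "m = k" by auto
  with m k show ?thesis by blast
qed

lemma joint_numerical_ranges_inter_iff:
  fixes S T :: "(complex^'n) set"
  assumes S: "vec.subspace S" "S \<noteq> UNIV" "moment S \<noteq> {}"
    and T: "vec.subspace T" "T \<noteq> UNIV" "moment T \<noteq> {}"
  shows "moment S \<inter> moment T \<noteq> {} \<longleftrightarrow>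
    joint_numerical_range (compressed_basis S) \<inter> joint_numerical_range (compressed_basis T) \<noteq> {0}"
    (is "_ \<longleftrightarrow> ?W S \<inter> ?W T \<noteq> _")
proof
  assume "moment S \<inter> moment T \<noteq> {}"
  then obtain m where m: "m \<in> moment S" "m \<in> moment T" by blast
  then have "(\<chi> i. complex_of_real (m $ i)) \<in> ?W S \<inter> ?W T"
    using moment_in_joint_numerical_range S(1) T(1) by blast
  moreover have "(\<chi> i. complex_of_real (m $ i)) \<noteq> 0"
    using m(1) by (rule moment_of_real_nonzero)
  ultimately show "?W S \<inter> ?W T \<noteq> {0}" by blast
next
  assume "?W S \<inter> ?W T \<noteq> {0}"
  \<comment> \<open>The intersection could also differ from \<open>{0}\<close> by being empty; this
    excludes that case.\<close>
  moreover have "0 \<in> ?W S \<inter> ?W T"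
    using zero_in_joint_numerical_range S T by blast
  ultimately obtain z where z: "z \<in> ?W S" "z \<in> ?W T" "z \<noteq> 0" by blast
  obtain r where r: "r \<in> cone hull (moment S)" "z = (\<chi> i. complex_of_real (r $ i))"
    using joint_numerical_range_in_cone_moment[OF S(1,3) z(1)] by blast
  obtain r' where r': "r' \<in> cone hull (moment T)" "z = (\<chi> i. complex_of_real (r' $ i))"
    using joint_numerical_range_in_cone_moment[OF T(1,3) z(2)] by blast
  have "r = r'" using r(2) r'(2) by (simp add: vec_eq_iff)
  moreover have "r \<noteq> 0" using z(3) r(2) by (auto simp: vec_eq_iff)
  ultimately show "moment S \<inter> moment T \<noteq> {}"
    using r(1) r'(1) cone_moments_inter by blast
qed

section \<open>Equivalence of the five optimality conditions\<close>

theorem theorem4: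
  fixes A0 :: "complex^'n^'n" and x :: "real^'n"
    and A :: "real^'n \<Rightarrow> complex^'n^'n"
    and N f g :: "real^'n \<Rightarrow> real"
    and S\<^sub>1 S\<^sub>n :: "(complex^'n) set"
  assumes "hermitian A0"
    and A: "\<And>y. A y = A0 + diag_mat y"
    and N: "\<And>y. N y = spectral_norm (A y)"
    and f: "\<And>y. f y = lambda_max (A y)"
    and g: "\<And>y. g y = - lambda_min (A y)"
    and "lambda_max (A x) = - lambda_min (A x)"
    and S1: "S\<^sub>1 = eigenspace (A x) (complex_of_real (lambda_max (A x)))"
    and Sn: "S\<^sub>n = eigenspace (A x) (complex_of_real (lambda_min (A x)))"
  defines "P1 \<equiv> 0 \<in> subdifferential N x"
    and "P2 \<equiv> 0 \<in> subdifferential f x + subdifferential g x"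
    and "P3 \<equiv> moment S\<^sub>1 \<inter> moment S\<^sub>n \<noteq> {}"
    and "P4 \<equiv> joint_numerical_range (compressed_basis S\<^sub>1)
              \<inter> joint_numerical_range (compressed_basis S\<^sub>n) \<noteq> {0}"
    and "P5 \<equiv> \<forall>y. spectral_norm (A x) \<le> spectral_norm (A y)"
  shows "(P1 \<longleftrightarrow> P2) \<and> (P2 \<longleftrightarrow> P3) \<and> (P3 \<longleftrightarrow> P4) \<and> (P4 \<longleftrightarrow> P5)"
proof -
  let ?l = "lambda_max (A x)"
  have hA: "hermitian (A y)" for y
    unfolding A by (intro hermitian_add assms(1) hermitian_diag_mat)
  have hA': "hermitian (- A y)" for y
    by (intro hermitian_uminus hA)
  have g': "g y = lambda_max (- A y)" for y
    by (simp add: g lambda_min_eq[OF hA])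
  have fg: "f x = ?l" "g x = ?l"
    using assms(6) by (simp_all add: f g)
  have Nfg: "N y = max (f y) (g y)" for y
    by (simp add: N spectral_norm_eq[OF hA] f g')
  \<comment> \<open>As a top eigenspace of \<open>- A x\<close>, \<open>S\<^sub>n\<close> is
    accessible to the results on the largest eigenvalue.\<close>
  have Sn': "S\<^sub>n = eigenspace (- A x) (complex_of_real (lambda_max (- A x)))"
    using eigenspace_uminus[of "A x" "complex_of_real (lambda_min (A x))"]
    by (simp add: Sn lambda_min_eq[OF hA])
  have f_shift: "f (x + h) = lambda_max (A x + diag_mat h)" for h
    unfolding f A by (rule arg_cong[of _ _ lambda_max]) (simp add: diag_mat_def vec_eq_iff)
  have g_shift: "g (x + h) = lambda_max (- A x + diag_mat (- h))" for h
    unfolding g' A by (rule arg_cong[of _ _ lambda_max]) (simp add: diag_mat_def vec_eq_iff)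

  have "P1 \<longleftrightarrow> P5"
    by (auto simp: P1_def P5_def subdifferential_def N)
  \<comment> \<open>The next three implications form the cycle \<open>P2\<close>, \<open>P5\<close>,
    \<open>P3\<close>, \<open>P2\<close>, proved in a different order.\<close>
  moreover have "P2 \<Longrightarrow> P5"
  proof -
    assume P2
    then obtain v w where "v + w = 0" and v: "v \<in> subdifferential f x" and w: "w \<in> subdifferential g x"
      unfolding P2_def by (metis set_plus_elim)
    then have "w = - v" by (simp add: add_eq_0_iff)
    have "N x \<le> N y" for y
    proof -
      have "inner v (y - x) \<le> f y - f x" "inner w (y - x) \<le> g y - g x"
        using v w by (simp_all add: subdifferential_def)
      \<comment> \<open>The opposite subgradients cancel in the sum. Since \<open>f x = g x\<close>,
        the larger of \<open>f y\<close> and \<open>g y\<close> is at least their mean and hence at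
        least \<open>N x\<close>.\<close>
      with \<open>w = - v\<close> have "f x + g x \<le> f y + g y" by simp
      then show ?thesis by (simp add: Nfg fg)
    qed
    then show P5 by (simp add: P5_def N)
  qed
  moreover have "P3 \<Longrightarrow> P2"
  proof -
    assume P3
    then obtain m where m: "m \<in> moment S\<^sub>1" "m \<in> moment S\<^sub>n"
      unfolding P3_def by blast
    have "inner m (y - x) \<le> f y - f x" for y
      using lambda_max_subgradient[OF hA m(1)[unfolded S1], of "y - x"] f_shift[of "y - x"]
      by (simp add: f)
    moreover have "inner (- m) (y - x) \<le> g y - g x" for y
      using lambda_max_subgradient[OF hA' m(2)[unfolded Sn'], of "- (y - x)"] g_shift[of "y - x"]
      by (simp add: g' inner_diff_right)
    ultimately have "m \<in> subdifferential f x" "- m \<in> subdifferential g x"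
      by (simp_all add: subdifferential_def)
    then show P2
      unfolding P2_def using set_plus_intro by fastforce
  qed
  moreover have "P5 \<Longrightarrow> P3"
  proof (rule ccontr)
    assume P5 and "\<not> P3"
    have closed: "closed S\<^sub>1" "closed S\<^sub>n"
      by (simp_all add: S1 Sn closed_eigenspace)
    obtain v where "norm v = 1" "A x *v v = ?l *\<^sub>R v"
      using lambda_max_eigenvector[OF hA] .
    then have "moment S\<^sub>1 \<noteq> {}"
      using abs_sq_in_moment[of v S\<^sub>1] by (auto simp: S1 eigenspace_real)
    then obtain h b where h: "\<forall>m\<in>moment S\<^sub>1. inner h m < b" "\<forall>m\<in>moment S\<^sub>n. b < inner h m"
      using separating_hyperplane_compact_closed[of "moment S\<^sub>1" "moment S\<^sub>n"] \<open>\<not> P3\<close> closed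
      by (auto simp: P3_def convex_moment compact_moment compact_imp_closed)
    \<comment> \<open>Points of a moment have coordinate sum one, so subtracting the constant vector \<open>b\<close> from \<open>h\<close>
      moves the separating level to zero.\<close>
    define k where "k = h - (\<chi> i. b)"
    have k: "inner k m = inner h m - b" if "m \<in> moment S" for m S
    proof -
      have "inner (\<chi> i. b) m = b"
        using sum_moment[OF that] by (simp add: inner_vec_def flip: sum_distrib_left)
      then show ?thesis by (simp add: k_def inner_diff_left)
    qed
    \<comment> \<open>Now \<open>k\<close> is negative on \<open>moment S\<^sub>1\<close> and
      positive on \<open>moment S\<^sub>n\<close>. Because \<open>g\<close> sees the perturbation
      with opposite sign, slope bound 0 applies to both functions and both decrease along
      \<open>k\<close>.\<close>
    have "\<exists>d>0. \<forall>t. 0 < t \<longrightarrow> t < d \<longrightarrow> lambda_max (A x + diag_mat (t *\<^sub>R k)) < ?l + t * 0"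
    proof (rule lambda_max_directional_bound[OF hA])
      fix v assume "v \<in> eigenspace (A x) (complex_of_real ?l)" "norm v = 1"
      then have "abs_sq v \<in> moment S\<^sub>1" by (simp add: S1 abs_sq_in_moment)
      then show "inner k (abs_sq v) < 0" using h(1) k by fastforce
    qed
    then obtain d where d: "d > 0"
      "\<And>t. 0 < t \<Longrightarrow> t < d \<Longrightarrow> lambda_max (A x + diag_mat (t *\<^sub>R k)) < ?l"
      by auto
    have "\<exists>d>0. \<forall>t. 0 < t \<longrightarrow> t < d \<longrightarrow>
        lambda_max (- A x + diag_mat (t *\<^sub>R (- k))) < lambda_max (- A x) + t * 0"
    proof (rule lambda_max_directional_bound[OF hA'])
      fix v assume "v \<in> eigenspace (- A x) (complex_of_real (lambda_max (- A x)))" "norm v = 1"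
      then have "abs_sq v \<in> moment S\<^sub>n" by (simp add: Sn' abs_sq_in_moment)
      then show "inner (- k) (abs_sq v) < 0" using h(2) k by fastforce
    qed
    then obtain e where e: "e > 0"
      "\<And>t. 0 < t \<Longrightarrow> t < e \<Longrightarrow> lambda_max (- A x + diag_mat (t *\<^sub>R (- k))) < lambda_max (- A x)"
      by auto
    define t where "t = min d e / 2"
    have t: "0 < t" "t < d" "t < e" using d(1) e(1) by (auto simp: t_def)
    have "f (x + t *\<^sub>R k) < ?l"
      using d(2)[OF t(1,2)] by (simp add: f_shift)
    moreover have "g (x + t *\<^sub>R k) < ?l"
      using e(2)[OF t(1,3)] fg(2) g'[of x] g_shift[of "t *\<^sub>R k"] by simp
    ultimately have "N (x + t *\<^sub>R k) < N x"
      by (simp add: Nfg fg)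
    moreover have "N x \<le> N (x + t *\<^sub>R k)"
      using \<open>P5\<close> by (simp add: P5_def N)
    ultimately show False by simp
  qed
  moreover have "P3 \<longleftrightarrow> P4"
  proof -
    obtain v where v: "norm v = 1" "A x *v v = ?l *\<^sub>R v"
      using lambda_max_eigenvector[OF hA] .
    obtain w where w: "norm w = 1" "- A x *v w = lambda_max (- A x) *\<^sub>R w"
      using lambda_max_eigenvector[OF hA'] .
    have v1: "v \<in> S\<^sub>1" and wn: "w \<in> S\<^sub>n"
      using v w by (simp_all add: S1 Sn' eigenspace_real)
    have ne: "moment S\<^sub>1 \<noteq> {}" "moment S\<^sub>n \<noteq> {}"
      using abs_sq_in_moment[OF v1 v(1)] abs_sq_in_moment[OF wn w(1)] by blast+
    have sub: "vec.subspace S\<^sub>1" "vec.subspace S\<^sub>n"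
      by (simp_all add: S1 Sn subspace_eigenspace)
    have min: "lambda_min (A x) = - ?l"
      using assms(6) by simp
    show ?thesis
    proof (cases "?l = 0")
      \<comment> \<open>The eigenspaces coincide, so \<open>P3\<close> holds trivially, and
        \<open>P4\<close> holds because a moment point gives a nonzero element of the common
        range.\<close>
      case True
      then have eq: "S\<^sub>n = S\<^sub>1"
        by (simp add: S1 Sn min)
      obtain m where m: "m \<in> moment S\<^sub>1" using ne(1) by blast
      then have "(\<chi> i. complex_of_real (m $ i)) \<in> joint_numerical_range (compressed_basis S\<^sub>1)"
        by (rule moment_in_joint_numerical_range[OF sub(1)])
      moreover have "(\<chi> i. complex_of_real (m $ i)) \<noteq> 0"
        using m by (rule moment_of_real_nonzero)
      ultimately show ?thesis
        using ne(1) by (auto simp: P3_def P4_def eq)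
    next
      case False
      \<comment> \<open>The eigenvalues \<open>?l\<close> and \<open>- ?l\<close> are now distinct,
        so each eigenspace misses a unit vector of the other and is proper.\<close>
      have "S\<^sub>1 \<inter> S\<^sub>n \<subseteq> {0}"
      proof
        fix u assume "u \<in> S\<^sub>1 \<inter> S\<^sub>n"
        then have "A x *v u = ?l *\<^sub>R u" "A x *v u = - ?l *\<^sub>R u"
          unfolding S1 Sn min eigenspace_real by blast+
        then have "(?l + ?l) *\<^sub>R u = 0"
          unfolding scaleR_left_distrib by simp
        with False show "u \<in> {0}" by simp
      qed
      then have "v \<notin> S\<^sub>n" "w \<notin> S\<^sub>1"
        using v1 wn v(1) w(1) by auto
      then show ?thesis
        unfolding P3_def P4_def
        by (intro joint_numerical_ranges_inter_iff sub ne) auto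
    qed
  qed
  ultimately show ?thesis by blast
qed

end
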